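(* Let $\{(W^k,H^k)\}_{k\ge 0}$ be a sequence generated by the column-wise update algorithm described in the context, which converges to $(W^*,H^* )$, where $W^*=[\mathbf w_1^*,\ldots,\mathbf w_r^*]$. Then, for any $1\le i\le r$, $$F(W^*,H^* )\le F(\mathbf w_1^*,\ldots,\mathbf w_{i-1}^*,\mathbf w_i,\mathbf w_{i+1}^*,\ldots,\mathbf w_r^*,H^* )+\delta_1\qquad\text{for all }\mathbf w_i\in\mathcal P_m\cap\mathcal Q_m^{s_1}.$$
   Context: Setting. Let $V=[\mathbf v_1,\ldots,\mathbf v_n]\in\mathbb R^{m\times n}$ be a column stochastic matrix (entrywise nonnegative, each column summing to $1$), let $r<\min\{m,n\}$ be a positive integer, and let $s_1,s_2>0$ be prescribed integer sparsity levels. $\|\cdot\|$ is the Euclidean norm, $\|\cdot\|_F$ the Frobenius norm, $\|\cdot\|_2$ the spectral norm, $\|\mathbf x\|_0$ the number of nonzero entries. For a matrix $A$, $A(i,:)$ is its $i$-th row. Put $\mathcal P_n=\{\mathbf x\in\mathbb R^n: \mathbf x\ge 0,\ \sum_j x_j=1\}$ and $\mathcal Q_n^s=\{\mathbf x\in\mathbb R^n:\|\mathbf x\|_0\le s\}$; $\delta_{\mathcal K}$ is the indicator function ($0$ on $\mathcal K$, $+\infty$ off $\mathcal K$). For $W=[\mathbf w_1,\ldots,\mathbf w_r]\in\mathbb R^{m\times r}$ and $H=[\mathbf h_1,\ldots,\mathbf h_n]\in\mathbb R^{r\times n}$ let $$f(W,H)=f(\mathbf w_1,\ldots,\mathbf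 w_r,\mathbf h_1,\ldots,\mathbf h_n)=\tfrac12\|V-WH\|_F^2,$$ $$F(W,H)=F(\mathbf w_1,\ldots,\mathbf w_r,H)=f(W,H)+\sum_{i=1}^r\big(\delta_{\mathcal P_m}(\mathbf w_i)+\delta_{\mathcal Q_m^{s_1}}(\mathbf w_i)\big)+\sum_{t=1}^n\big(\delta_{\mathcal P_r}(\mathbf h_t)+\delta_{\mathcal Q_r^{s_2}}(\mathbf h_t)\big).$$ $\Pi_{\mathcal D}(\mathbf y)$ denotes the metric projection (a nearest point of $\mathcal D$ to $\mathbf y$); when the nearest point or an argmin is not unique, any choice is allowed. Algorithm. Choose $W^0$ with all columns in $\mathcal P_m\cap\mathcal Q_m^{s_1}$, $H^0$ with all columns in $\mathcal P_r\cap\mathcal Q_r^{s_2}$, $\delta_1>0$, $\delta_2>0$, $c\ge 1/\delta_2$. For $k=0,1,2,\ldots$: Step 1. For $i=1,\ldots,r$ in order: let $\phi_{i,k}(\mathbf w)=f(\mathbf w_1^{k+1},\ldots,\mathbf w_{i-1}^{k+1},\mathbf w,\mathbf w_{i+1}^k,\ldots,\mathbf w_r^k,H^k)$. If $\|H^k(i,:)\|=0$, set $\mathbf w_i^{k+1}=\mathbf w_i^k$. Otherwise compute $\bar{\mathbf w}_i^k=\operatorname{argmin}_{\mathbf w\in\mathcal P_m\cap\mathcal Q_m^{s_1}}\phi_{i,k}(\mathbf w)$; if $\phi_{i,k}(\mathbf w_i^k)-\phi_{i,k}(\bar{\mathbf w}_i^k)\ge\frac{\delta_1}{2}\|\mathbf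 w_i^k-\bar{\mathbf w}_i^k\|^2$, set $\mathbf w_i^{k+1}=\bar{\mathbf w}_i^k$; else set $\mathbf w_i^{k+1}=\Pi_{\mathcal P_m\cap\mathcal Q_m^{s_1}}(\mathbf w_i^k-\mu_{ik}\nabla\phi_{i,k}(\mathbf w_i^k))$ with $\mu_{ik}=1/(\|H^k(i,:)\|^2+\delta_1)$. Set $W^{k+1}=[\mathbf w_1^{k+1},\ldots,\mathbf w_r^{k+1}]$. Step 2. For $t=1,\ldots,n$: let $\psi_{t,k}(\mathbf h)=f(W^{k+1},\mathbf h_1^k,\ldots,\mathbf h_{t-1}^k,\mathbf h,\mathbf h_{t+1}^k,\ldots,\mathbf h_n^k)$, so $\nabla\psi_{t,k}(\mathbf h)=(W^{k+1})^T(W^{k+1}\mathbf h-\mathbf v_t)$. Take $\nu_{tk}=\min\{c,\ \|\nabla\psi_{t,k}(\mathbf h_t^k)\|^2/\|W^{k+1}\nabla\psi_{t,k}(\mathbf h_t^k)\|^2\}$ (equal to $c$ if the denominator is $0$) and compute $\bar{\mathbf h}_t^k=\Pi_{\mathcal P_r\cap\mathcal Q_r^{s_2}}(\mathbf h_t^k-\nu_{tk}\nabla\psi_{t,k}(\mathbf h_t^k))$. If $\psi_{t,k}(\mathbf h_t^k)-\psi_{t,k}(\bar{\mathbf h}_t^k)\ge\frac{\delta_2}{2}\|\mathbf h_t^k-\bar{\mathbf h}_t^k\|^2$, set $\mathbf h_t^{k+1}=\bar{\mathbf h}_t^k$; else redefine $\nu_{tk}=1/(\|(W^{k+1})^TW^{k+1}\|_2+\delta_2)$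 and set $\mathbf h_t^{k+1}=\Pi_{\mathcal P_r\cap\mathcal Q_r^{s_2}}(\mathbf h_t^k-\nu_{tk}\nabla\psi_{t,k}(\mathbf h_t^k))$. Set $H^{k+1}=[\mathbf h_1^{k+1},\ldots,\mathbf h_n^{k+1}]$. *)

theory Defs
  imports "HOL-Analysis.Analysis"
begin

definition prob_simplex :: "(real ^ 'n) set" where
  "prob_simplex = {x. (\<forall>j. 0 \<le> x $ j) \<and> (\<Sum>j\<in>UNIV. x $ j) = 1}"

definition l0_norm :: "real ^ 'n \<Rightarrow> nat" where
  "l0_norm x = card {j. x $ j \<noteq> 0}"

definition sparse_vecs :: "nat \<Rightarrow> (real ^ 'n) set" where
  "sparse_vecs s = {x. l0_norm x \<le> s}"

definition column_stochastic :: "real ^ 'n ^ 'm \<Rightarrow> bool" where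
  "column_stochastic A \<longleftrightarrow>
     (\<forall>i j. 0 \<le> A $ i $ j) \<and> (\<forall>j. (\<Sum>i\<in>UNIV. A $ i $ j) = 1)"

definition mat_of_columns :: "('r \<Rightarrow> real ^ 'm) \<Rightarrow> real ^ 'r ^ 'm" where
  "mat_of_columns w = (\<chi> a j. w j $ a)"

definition ind_fun :: "'a set \<Rightarrow> 'a \<Rightarrow> ereal" where
  "ind_fun K x = (if x \<in> K then 0 else \<infinity>)"

text \<open>The library norm on matrices is the Frobenius norm.\<close>

lemma norm_matrix_eq_frobenius:
  fixes A :: "real ^ 'n ^ 'm"
  shows "norm A = sqrt (\<Sum>i\<in>UNIV. \<Sum>j\<in>UNIV. (A $ i $ j)\<^sup>2)"
  by (simp add: norm_vec_def L2_set_def sum_nonneg)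

definition nmf_loss :: "real ^ 'n ^ 'm \<Rightarrow> real ^ 'r ^ 'm \<Rightarrow> real ^ 'n ^ 'r \<Rightarrow> real" where
  "nmf_loss V W H = 1 / 2 * (norm (V - W ** H))\<^sup>2"

definition nmf_objective ::
  "real ^ 'n ^ 'm \<Rightarrow> nat \<Rightarrow> nat \<Rightarrow> real ^ 'r ^ 'm \<Rightarrow> real ^ 'n ^ 'r \<Rightarrow> ereal" where
  "nmf_objective V s1 s2 W H =
     ereal (nmf_loss V W H)
     + (\<Sum>i\<in>UNIV. ind_fun prob_simplex (column i W) + ind_fun (sparse_vecs s1) (column i W))
     + (\<Sum>t\<in>UNIV. ind_fun prob_simplex (column t H) + ind_fun (sparse_vecs s2) (column t H))"

definition grad :: "('a::real_inner \<Rightarrow> real) \<Rightarrow> 'a \<Rightarrow> 'a" where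
  "grad f x = (THE D. GDERIV f x :> D)"

text \<open>Projections and minimisers onto the nonconvex constraint sets need not be unique, so they
  are relations, and so is the whole iteration.\<close>

definition is_projection :: "'a::metric_space set \<Rightarrow> 'a \<Rightarrow> 'a \<Rightarrow> bool" where
  "is_projection D y x \<longleftrightarrow> is_arg_min (\<lambda>z. dist y z) (\<lambda>z. z \<in> D) x"

definition spectral_norm :: "real ^ 'n ^ 'm \<Rightarrow> real" where
  "spectral_norm A = onorm (\<lambda>x. A *v x)"

text \<open>In the two block functions below, \<^term>\<open>W\<close> and \<^term>\<open>H\<close> are the current iterates and
  \<^term>\<open>W'\<close> is the next one. The columns of \<^term>\<open>W\<close> are swept in the order of the index type
  \<open>'r\<close>, so the columns before \<^term>\<open>i\<close> are already updated.\<close>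

definition W_block :: "real ^ 'n ^ 'm \<Rightarrow> real ^ ('r::{finite,linorder}) ^ 'm
    \<Rightarrow> real ^ ('r::{finite,linorder}) ^ 'm
    \<Rightarrow> real ^ 'n ^ ('r::{finite,linorder}) \<Rightarrow> 'r \<Rightarrow> real ^ 'm \<Rightarrow> real" where
  "W_block V W W' H i w =
     nmf_loss V
       (mat_of_columns (\<lambda>j. if j < i then column j W' else if j = i then w else column j W)) H"

definition H_block :: "real ^ 'n ^ 'm \<Rightarrow> real ^ 'r ^ 'm \<Rightarrow> real ^ 'n ^ 'r \<Rightarrow> 'n
    \<Rightarrow> real ^ 'r \<Rightarrow> real" where
  "H_block V W' H t h = nmf_loss V W' (mat_of_columns ((\<lambda>j. column j H)(t := h)))"

definition W_step :: "real ^ 'n ^ 'm \<Rightarrow> nat \<Rightarrow> real \<Rightarrow> real ^ ('r::{finite,linorder}) ^ 'm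
    \<Rightarrow> real ^ ('r::{finite,linorder}) ^ 'm
    \<Rightarrow> real ^ 'n ^ ('r::{finite,linorder}) \<Rightarrow> 'r \<Rightarrow> bool" where
  "W_step V s1 \<delta>1 W W' H i \<longleftrightarrow>
     (let K = prob_simplex \<inter> sparse_vecs s1;
          \<phi> = W_block V W W' H i;
          w = column i W;
          w' = column i W';
          \<mu> = 1 / ((norm (row i H))\<^sup>2 + \<delta>1)
      in if norm (row i H) = 0 then w' = w
         else \<exists>wbar. is_arg_min \<phi> (\<lambda>z. z \<in> K) wbar \<and>
                (if \<phi> w - \<phi> wbar \<ge> \<delta>1 / 2 * (norm (w - wbar))\<^sup>2
                 then w' = wbar
                 else is_projection K (w - \<mu> *\<^sub>R grad \<phi> w) w'))"

definition H_step :: "real ^ 'n ^ 'm \<Rightarrow> nat \<Rightarrow> real \<Rightarrow> real \<Rightarrow> real ^ 'r ^ 'm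
    \<Rightarrow> real ^ 'n ^ 'r \<Rightarrow> real ^ 'n ^ 'r \<Rightarrow> 'n \<Rightarrow> bool" where
  "H_step V s2 \<delta>2 c W' H H' t \<longleftrightarrow>
     (let K = prob_simplex \<inter> sparse_vecs s2;
          \<psi> = H_block V W' H t;
          h = column t H;
          h' = column t H';
          g = grad \<psi> h;
          \<nu> = (if (norm (W' *v g))\<^sup>2 = 0 then c
               else min c ((norm g)\<^sup>2 / (norm (W' *v g))\<^sup>2));
          \<nu>' = 1 / (spectral_norm (transpose W' ** W') + \<delta>2)
      in \<exists>hbar. is_projection K (h - \<nu> *\<^sub>R g) hbar \<and>
           (if \<psi> h - \<psi> hbar \<ge> \<delta>2 / 2 * (norm (h - hbar))\<^sup>2
            then h' = hbar
            else is_projection K (h - \<nu>' *\<^sub>R g) h'))"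

definition generated_by_algorithm ::
  "real ^ 'n ^ 'm \<Rightarrow> nat \<Rightarrow> nat \<Rightarrow> real \<Rightarrow> real \<Rightarrow> real
    \<Rightarrow> (nat \<Rightarrow> real ^ ('r::{finite,linorder}) ^ 'm)
    \<Rightarrow> (nat \<Rightarrow> real ^ 'n ^ ('r::{finite,linorder})) \<Rightarrow> bool" where
  "generated_by_algorithm V s1 s2 \<delta>1 \<delta>2 c W H \<longleftrightarrow>
     (\<forall>i. column i (W 0) \<in> prob_simplex \<inter> sparse_vecs s1) \<and>
     (\<forall>t. column t (H 0) \<in> prob_simplex \<inter> sparse_vecs s2) \<and>
     (\<forall>k. (\<forall>i. W_step V s1 \<delta>1 (W k) (W (Suc k)) (H k) i) \<and>
          (\<forall>t. H_step V s2 \<delta>2 c (W (Suc k)) (H k) (H (Suc k)) t))"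

end

theory Submission
  imports Defs
begin

text \<open>
  Along an update of a column \<open>i\<close> whose row of \<open>H\<close> is nonzero, either the new column is a global
  minimiser of the block function, or the failed descent test says that the old column is within
  \<open>\<delta>1 / 2 * (norm (w - wbar))\<^sup>2\<close> of the minimum. Two points of the probability simplex are
  at squared distance at most \<open>2\<close>, so the error is at most \<open>\<delta>1\<close>, and since old and new columns have
  the same limit, continuity of the loss carries the inequality over to the limit point. If the
  limiting row of \<open>H\<close> vanishes, the loss does not depend on column \<open>i\<close> at all.
\<close>

lemma column_mat_of_columns [simp]: "column j (mat_of_columns w) = w j"
  by (simp add: mat_of_columns_def column_def vec_eq_iff)

lemma mat_of_columns_column [simp]: "mat_of_columns (\<lambda>j. column j A) = A"
  by (simp add: mat_of_columns_def column_def vec_eq_iff)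

lemma norm_prob_simplex_le_1:
  assumes "x \<in> prob_simplex"
  shows "norm x \<le> 1"
  using norm_le_l1_cart[of x] assms by (simp add: prob_simplex_def)

text \<open>Nonnegative entries give \<open>x \<bullet> y \<ge> 0\<close>, so expanding the square
  leaves at most 1 + 1. The triangle inequality alone would give 4, and hence an error of 2 *
  \<open>\<delta>1\<close> in the end; the constant 2 cancels the factor 1/2 of the descent
  test.\<close>

lemma norm_diff_prob_simplex_le:
  assumes "x \<in> prob_simplex" "y \<in> prob_simplex"
  shows "(norm (x - y))\<^sup>2 \<le> 2"
proof -
  have "x \<bullet> y \<ge> 0"
    using assms by (auto simp: inner_vec_def prob_simplex_def intro!: sum_nonneg)
  moreover have "(norm x)\<^sup>2 \<le> 1" "(norm y)\<^sup>2 \<le> 1"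
    using assms by (simp_all add: norm_prob_simplex_le_1 power_le_one)
  moreover have "(norm (x - y))\<^sup>2 = (norm x)\<^sup>2 + (norm y)\<^sup>2 - 2 * (x \<bullet> y)"
    by (simp add: power2_norm_eq_inner inner_diff inner_commute)
  ultimately show ?thesis by linarith
qed

lemma closed_prob_simplex: "closed prob_simplex"
  unfolding prob_simplex_def
  by (intro closed_Collect_conj closed_Collect_all closed_Collect_le closed_Collect_eq
      continuous_intros)

text \<open>Supports can only shrink in the limit: each nonzero entry of \<open>l\<close> is
  eventually nonzero in \<open>x n\<close>, and as there are finitely many entries, one
  \<open>n\<close> serves them all.\<close>

lemma closed_sparse_vecs: "closed (sparse_vecs s :: (real ^ 'n) set)"
  unfolding closed_sequential_limits
proof (intro allI impI, elim conjE)
  fix x :: "nat \<Rightarrow> real ^ 'n" and l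
  assume x: "\<forall>n. x n \<in> sparse_vecs s" and lim: "x \<longlonglongrightarrow> l"
  have "\<forall>\<^sub>F n in sequentially. l $ j \<noteq> 0 \<longrightarrow> x n $ j \<noteq> 0" for j
    by (cases "l $ j = 0")
      (auto intro: tendsto_imp_eventually_ne tendsto_vec_nth[OF lim] elim: eventually_mono)
  then have "\<forall>\<^sub>F n in sequentially. \<forall>j. l $ j \<noteq> 0 \<longrightarrow> x n $ j \<noteq> 0"
    by (rule eventually_all_finite)
  then obtain n where "\<And>j. l $ j \<noteq> 0 \<Longrightarrow> x n $ j \<noteq> 0"
    by (auto simp: eventually_sequentially)
  then have "card {j. l $ j \<noteq> 0} \<le> card {j. x n $ j \<noteq> 0}"
    by (intro card_mono) auto
  also have "\<dots> \<le> s"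
    using x by (simp add: sparse_vecs_def l0_norm_def)
  finally show "l \<in> sparse_vecs s"
    by (simp add: sparse_vecs_def l0_norm_def)
qed

lemma tendsto_nmf_loss:
  assumes "(A \<longlongrightarrow> A') F" "(B \<longlongrightarrow> B') F"
  shows "((\<lambda>k. nmf_loss V (A k) (B k)) \<longlongrightarrow> nmf_loss V A' B') F"
  unfolding nmf_loss_def matrix_matrix_mult_def
  by (intro tendsto_intros tendsto_vec_lambda assms)

lemma tendsto_column:
  assumes "(A \<longlongrightarrow> A') F"
  shows "((\<lambda>k. column j (A k)) \<longlongrightarrow> column j A') F"
  unfolding column_def by (intro tendsto_vec_lambda tendsto_vec_nth assms)

lemma tendsto_mat_of_columns:
  assumes "\<And>j. ((\<lambda>k. u k j) \<longlongrightarrow> u' j) F"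
  shows "((\<lambda>k. mat_of_columns (u k)) \<longlongrightarrow> mat_of_columns u') F"
  unfolding mat_of_columns_def by (intro tendsto_vec_lambda tendsto_vec_nth assms)

text \<open>The block function mixes columns of the old and the new iterate. Both have the limit
  \<open>W\<close>, so the order of the sweep leaves no trace in the limit.\<close>

lemma tendsto_W_block:
  assumes "(A \<longlongrightarrow> W) F" "(A' \<longlongrightarrow> W) F" "(B \<longlongrightarrow> H) F" "(u \<longlongrightarrow> u') F"
  shows "((\<lambda>k. W_block V (A k) (A' k) (B k) i (u k))
    \<longlongrightarrow> nmf_loss V (mat_of_columns ((\<lambda>j. column j W)(i := u'))) H) F"
  unfolding W_block_def
proof (intro tendsto_nmf_loss tendsto_mat_of_columns assms(3))
  fix j
  show "((\<lambda>k. if j < i then column j (A' k) else if j = i then u k else column j (A k))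
    \<longlongrightarrow> ((\<lambda>j. column j W)(i := u')) j) F"
    using assms by (cases "j < i"; cases "j = i") (auto intro: tendsto_column)
qed

text \<open>Column \<open>i\<close> of the left factor enters the product only multiplied by entries
  of row \<open>i\<close> of \<open>H\<close>.\<close>

lemma matrix_mult_update_column_row_0:
  fixes H :: "real ^ 'n ^ 'r" and u :: "'r \<Rightarrow> real ^ 'm"
  assumes "row i H = 0"
  shows "mat_of_columns (u(i := w)) ** H = mat_of_columns u ** H"
proof -
  have "H $ i $ t = 0" for t
    using assms by (simp add: row_def vec_eq_iff)
  then show ?thesis
    by (auto simp: matrix_matrix_mult_def mat_of_columns_def vec_eq_iff intro!: sum.cong)
qed

lemma W_step_feasible:
  assumes "W_step V s1 \<delta>1 W W' H i"
    and "column i W \<in> prob_simplex \<inter> sparse_vecs s1"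
  shows "column i W' \<in> prob_simplex \<inter> sparse_vecs s1"
  using assms
  by (auto simp: W_step_def Let_def is_projection_def is_arg_min_def split: if_splits)

text \<open>Which branch is taken may change from one iteration to the next. The minimum covers
  both: the new column attains the block minimum if the test succeeds, and the old column is within
  \<open>\<delta>1\<close> of it if the test fails.\<close>

lemma W_step_near_optimal:
  assumes step: "W_step V s1 \<delta>1 W W' H i"
    and "row i H \<noteq> 0" "\<delta>1 > 0"
    and col: "column i W \<in> prob_simplex"
    and w: "w \<in> prob_simplex \<inter> sparse_vecs s1"
  defines "\<phi> \<equiv> W_block V W W' H i"
  shows "min (\<phi> (column i W)) (\<phi> (column i W')) \<le> \<phi> w + \<delta>1"
proof -
  obtain wbar where argmin: "is_arg_min \<phi> (\<lambda>z. z \<in> prob_simplex \<inter> sparse_vecs s1) wbar"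
    and test: "\<phi> (column i W) - \<phi> wbar \<ge> \<delta>1 / 2 * (norm (column i W - wbar))\<^sup>2
      \<Longrightarrow> column i W' = wbar"
    using step \<open>row i H \<noteq> 0\<close> unfolding W_step_def Let_def \<phi>_def
    by (auto split: if_splits)
  have le: "\<phi> wbar \<le> \<phi> w" and wbar: "wbar \<in> prob_simplex"
    using argmin w by (auto simp: is_arg_min_linorder)
  show ?thesis
  proof (cases "\<phi> (column i W) - \<phi> wbar \<ge> \<delta>1 / 2 * (norm (column i W - wbar))\<^sup>2")
    case True
    then show ?thesis using test le \<open>\<delta>1 > 0\<close> by simp
  next
    case False
    have "\<delta>1 / 2 * (norm (column i W - wbar))\<^sup>2 \<le> \<delta>1 / 2 * 2"
      using norm_diff_prob_simplex_le[OF col wbar] \<open>\<delta>1 > 0\<close> by (intro mult_left_mono) auto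
    with False le show ?thesis by linarith
  qed
qed

theorem theorem3p12:
  fixes V :: "real ^ 'n ^ 'm"
    and W :: "nat \<Rightarrow> real ^ ('r::{finite,linorder}) ^ 'm"
    and H :: "nat \<Rightarrow> real ^ 'n ^ ('r::{finite,linorder})"
    and Wstar :: "real ^ ('r::{finite,linorder}) ^ 'm" and Hstar :: "real ^ 'n ^ ('r::{finite,linorder})"
    and s1 s2 :: nat and \<delta>1 \<delta>2 c :: real
  assumes "column_stochastic V"
    and "CARD('r) < min CARD('m) CARD('n)"
    and "s1 > 0" and "s2 > 0"
    and "\<delta>1 > 0" and "\<delta>2 > 0" and "c \<ge> 1 / \<delta>2"
    and "generated_by_algorithm V s1 s2 \<delta>1 \<delta>2 c W H"
    and "(\<lambda>k. (W k, H k)) \<longlonglongrightarrow> (Wstar, Hstar)"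
  shows "\<forall>i. \<forall>w \<in> prob_simplex \<inter> sparse_vecs s1.
    nmf_objective V s1 s2 Wstar Hstar
      \<le> nmf_objective V s1 s2 (mat_of_columns ((\<lambda>j. column j Wstar)(i := w))) Hstar + ereal \<delta>1"
proof (intro allI ballI)
  fix i :: 'r and w :: "real ^ 'm"
  assume w: "w \<in> prob_simplex \<inter> sparse_vecs s1"
  let ?K = "prob_simplex \<inter> sparse_vecs s1"
  let ?W' = "mat_of_columns ((\<lambda>j. column j Wstar)(i := w))"
  have step: "W_step V s1 \<delta>1 (W k) (W (Suc k)) (H k) j" for k j
    using assms(8) by (simp add: generated_by_algorithm_def)
  have feas: "column j (W k) \<in> ?K" for j k
  proof (induction k)
    case 0
    show ?case using assms(8) by (simp add: generated_by_algorithm_def)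
  next
    case (Suc k)
    then show ?case by (rule W_step_feasible[OF step])
  qed
  have limW: "W \<longlonglongrightarrow> Wstar" and limH: "H \<longlonglongrightarrow> Hstar"
    using tendsto_fst[OF assms(9)] tendsto_snd[OF assms(9)] by simp_all
  have limW': "(\<lambda>k. W (Suc k)) \<longlonglongrightarrow> Wstar"
    by (rule LIMSEQ_Suc[OF limW])
  \<comment> \<open>Feasibility survives the limit, so the indicator terms of column
    \<open>i\<close> of \<open>Wstar\<close> vanish.\<close>
  have star: "column i Wstar \<in> ?K"
    by (rule closed_sequentially[OF _ feas tendsto_column[OF limW]])
      (intro closed_Int closed_prob_simplex closed_sparse_vecs)

  have loss: "nmf_loss V Wstar Hstar \<le> nmf_loss V ?W' Hstar + \<delta>1"
  proof (cases "row i Hstar = 0")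
    case True
    then show ?thesis
      using \<open>\<delta>1 > 0\<close> by (simp add: nmf_loss_def matrix_mult_update_column_row_0)
  next
    case False
    have "(\<lambda>k. row i (H k)) \<longlonglongrightarrow> row i Hstar"
      unfolding row_def by (intro tendsto_vec_lambda tendsto_vec_nth limH)
    \<comment> \<open>From some \<open>k\<close> on, the update is not the trivial one that keeps
      the column, so the near-optimality bound is available.\<close>
    then have ev: "\<forall>\<^sub>F k in sequentially. row i (H k) \<noteq> 0"
      using False by (rule tendsto_imp_eventually_ne)
    let ?\<phi> = "\<lambda>k. W_block V (W k) (W (Suc k)) (H k) i"
    note lim = tendsto_W_block[OF limW limW' limH, of _ _ V i]
    have "(\<lambda>k. ?\<phi> k (column i (W k))) \<longlonglongrightarrow> nmf_loss V Wstar Hstar"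
      "(\<lambda>k. ?\<phi> k (column i (W (Suc k)))) \<longlonglongrightarrow> nmf_loss V Wstar Hstar"
      using lim[OF tendsto_column[OF limW, of i]] lim[OF tendsto_column[OF limW', of i]]
      by (simp_all add: fun_upd_idem)
    \<comment> \<open>Both arguments share one limit, so their minimum converges to it without any
      choice of a subsequence on which one branch recurs.\<close>
    from tendsto_min[OF this]
    have "(\<lambda>k. min (?\<phi> k (column i (W k))) (?\<phi> k (column i (W (Suc k)))))
      \<longlonglongrightarrow> nmf_loss V Wstar Hstar" by simp
    moreover have "(\<lambda>k. ?\<phi> k w + \<delta>1) \<longlonglongrightarrow> nmf_loss V ?W' Hstar + \<delta>1"
      by (intro tendsto_intros lim)
    moreover have "\<forall>\<^sub>F k in sequentially.
        min (?\<phi> k (column i (W k))) (?\<phi> k (column i (W (Suc k)))) \<le> ?\<phi> k w + \<delta>1"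
      using ev
    proof eventually_elim
      case (elim k)
      then show ?case
        using W_step_near_optimal[OF step elim \<open>\<delta>1 > 0\<close>] feas w by blast
    qed
    ultimately show ?thesis
      by (intro tendsto_le[OF sequentially_bot])
  qed

  let ?D = "\<lambda>A. \<Sum>j\<in>UNIV. ind_fun prob_simplex (column j A) + ind_fun (sparse_vecs s1) (column j A)"
  \<comment> \<open>The comparison is termwise: the two matrices agree outside column
    \<open>i\<close>, and in column \<open>i\<close> the left-hand term is 0.\<close>
  have "?D Wstar \<le> ?D ?W'"
    using star by (intro sum_mono) (auto simp: ind_fun_def)
  with loss have "(ereal (nmf_loss V Wstar Hstar) + ?D Wstar)
      \<le> ereal (nmf_loss V ?W' Hstar + \<delta>1) + ?D ?W'"
    by (intro add_mono) auto
  \<comment> \<open>Adding the same sum to both sides preserves the inequality in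
    \<open>ereal\<close> even if that sum is infinite.\<close>
  from add_right_mono[OF this, of "\<Sum>t\<in>UNIV. ind_fun prob_simplex (column t Hstar)
      + ind_fun (sparse_vecs s2) (column t Hstar)"]
  show "nmf_objective V s1 s2 Wstar Hstar \<le> nmf_objective V s1 s2 ?W' Hstar + ereal \<delta>1"
    unfolding nmf_objective_def by (simp add: ac_simps flip: plus_ereal.simps(1))
qed

end
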